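(* Let $a\ge 2$ and $n\ge a^2$ be integers, let $b=\binom{a}{2}$ and $k=\lfloor n/(2b)\rfloor$. Then $$\frac12\binom{2k}{k}\le p(a,2,n)\le \frac{1}{2b}\binom{n}{\lceil n/a\rceil}.$$
   Context: Let $\Sigma_a=\{0,1,\ldots,a-1\}$. For $\mathbf{v}\in\Sigma_a^n$ and $r\in[n]=\{1,\ldots,n\}$, $\mathbf{v}[r]$ denotes the $r$-th coordinate of $\mathbf{v}$. A set of vectors $\mathcal{V}=\{\mathbf{v}_1,\ldots,\mathbf{v}_m\}\subseteq \Sigma_a^n$ is called $2$-wise perfect with respect to $\Sigma_a$ if (i) $|\mathcal{V}|\ge 2$, and (ii) for every pair $(\mathbf{v}_{i},\mathbf{v}_{j})$ with $1\le i<j\le m$ and every string $\alpha\in\Sigma_a^2$, there is some $r\in[n]$ with $\mathbf{v}_{i}[r]\,\mathbf{v}_{j}[r]=\alpha$. For $n\ge a^2$ (for which such sets exist), $p(a,2,n)$ denotes the maximum size of a $2$-wise perfect set of vectors of length $n$ over $\Sigma_a$. *)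

theory Defs
  imports Complex_Main
begin

definition words :: "nat \<Rightarrow> nat \<Rightarrow> nat list set" where
  "words a n = {v. length v = n \<and> set v \<subseteq> {0..<a}}"

text \<open>Coordinates are numbered from \<open>0\<close> to \<open>n - 1\<close>. The members of \<open>V\<close> are not indexed:
  since \<open>\<alpha>\<close> ranges over all strings of length two, and hence also over the reversed ones,
  requiring the condition for both orders of a pair of distinct vectors amounts to requiring it
  for the one order that an enumeration of \<open>V\<close> singles out.\<close>

definition two_wise_perfect :: "nat \<Rightarrow> nat \<Rightarrow> nat list set \<Rightarrow> bool" where
  "two_wise_perfect a n V \<longleftrightarrow>
     V \<subseteq> words a n \<and> card V \<ge> 2 \<and>
     (\<forall>u\<in>V. \<forall>v\<in>V. u \<noteq> v \<longrightarrow> (\<forall>\<alpha>\<in>words a 2. \<exists>r<n. [u ! r, v ! r] = \<alpha>))"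

definition max_two_wise_perfect :: "nat \<Rightarrow> nat \<Rightarrow> nat" where
  "max_two_wise_perfect a n = Max (card ` {V. two_wise_perfect a n V})"

text \<open>The maximum is taken over a finite set, which is nonempty for \<open>a \<ge> 2\<close> and \<open>n \<ge> a\<^sup>2\<close>.\<close>

lemma finite_words: "finite (words a n)"
  using finite_lists_length_eq[of "{0..<a}" n] by (simp add: words_def conj_commute)

lemma finite_two_wise_perfect: "finite {V. two_wise_perfect a n V}"
  by (rule finite_subset[of _ "Pow (words a n)"])
     (auto simp: two_wise_perfect_def finite_words)

lemma two_wise_perfect_exists:
  assumes a: "a \<ge> 2" and n: "n \<ge> a\<^sup>2"
  shows "\<exists>V. two_wise_perfect a n V"
proof -
  define u where "u = map (\<lambda>r. (r div a) mod a) [0..<n]"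
  define v where "v = map (\<lambda>r. r mod a) [0..<n]"
  have n1: "1 < n"
    using power_mono[of 2 a 2] a n by simp
  have "u ! 1 \<noteq> v ! 1"
    using n1 a by (simp add: u_def v_def)
  then have uv: "u \<noteq> v" by auto
  have cover: "\<exists>r<n. u ! r = x \<and> v ! r = y" if "x < a" "y < a" for x y
  proof (intro exI conjI)
    have "x * a + y < Suc x * a" using that by simp
    also have "\<dots> \<le> a * a" using that by (intro mult_right_mono) auto
    also have "\<dots> \<le> n" using n by (simp add: power2_eq_square)
    finally show r: "x * a + y < n" .
    show "u ! (x * a + y) = x" "v ! (x * a + y) = y"
      using r that by (simp_all add: u_def v_def)
  qed
  have words2: "\<exists>x y. \<alpha> = [x, y] \<and> x < a \<and> y < a" if "\<alpha> \<in> words a 2" for \<alpha>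
    using that by (auto simp: words_def length_Suc_conv numeral_2_eq_2)
  have "two_wise_perfect a n {u, v}"
    unfolding two_wise_perfect_def
  proof (intro conjI ballI impI)
    show "{u, v} \<subseteq> words a n" using a by (auto simp: words_def u_def v_def)
    show "2 \<le> card {u, v}" using uv by simp
    fix s t \<alpha> assume st: "s \<in> {u, v}" "t \<in> {u, v}" "s \<noteq> t" and "\<alpha> \<in> words a 2"
    then obtain x y where "\<alpha> = [x, y]" "x < a" "y < a" using words2 by blast
    then show "\<exists>r<n. [s ! r, t ! r] = \<alpha>"
      using st cover[of x y] cover[of y x] by auto
  qed
  then show ?thesis ..
qed

end

theory Submission
  imports Defs
begin

text \<open>Upper bound: a vector splits the coordinates into \<open>a\<close> classes, and any two classes of
  distinct vectors meet. If \<open>A\<close> and \<open>B\<close> are two classes of a vector with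
  \<open>card A + card B \<le> 2 * n / a\<close>, the pairs \<open>(A, B)\<close> and \<open>(B, A)\<close> over all vectors satisfy the
  hypotheses of the Bollobas set-pair inequality, so with \<open>N = \<lfloor>2 * n / a\<rfloor>\<close> twice the number of
  vectors is at most the central binomial coefficient of \<open>N\<close>. Since \<open>N \<le> 2 * n / a\<close>, lowering \<open>n\<close>
  to \<open>N\<close> divides \<open>n choose q\<close>, where \<open>q = \<lfloor>n / a\<rfloor>\<close>, by at least
  \<open>(a / 2) ^ q \<ge> a choose 2\<close>.

  Lower bound: the \<open>k\<close>-subsets of a \<open>2 * k\<close>-set that contain a fixed point are pairwise
  qualitatively independent; write each of them once for every pair of symbols, in consecutive
  blocks of length \<open>2 * k\<close>.\<close>

section \<open>The Bollobas set-pair inequality\<close>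

text \<open>Induction on the ground set: deleting a point \<open>x\<close> from every \<open>B i\<close> with \<open>x \<notin> A i\<close>, and
  dropping the other pairs, keeps the hypotheses; averaging over \<open>x\<close> reproduces each weight.\<close>

lemma set_pair_inequality:
  fixes A B :: "'i \<Rightarrow> 'a set"
  assumes "finite X" "finite I"
    and "\<And>i. i \<in> I \<Longrightarrow> A i \<subseteq> X \<and> B i \<subseteq> X"
    and "\<And>i. i \<in> I \<Longrightarrow> A i \<inter> B i = {}"
    and "\<And>i j. i \<in> I \<Longrightarrow> j \<in> I \<Longrightarrow> i \<noteq> j \<Longrightarrow> A i \<inter> B j \<noteq> {}"
  shows "(\<Sum>i\<in>I. 1 / real ((card (A i) + card (B i)) choose card (A i))) \<le> 1"
  using assms
proof (induction "card X" arbitrary: X I B)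
  case 0
  \<comment> \<open>Two distinct indices would need a common point inside the empty ground
    set.\<close>
  have "I = {} \<or> (\<exists>i. I = {i})"
    using 0 by (metis card_0_eq inf_bot_right is_singletonI' is_singleton_the_elem subset_empty)
  then show ?case by (auto simp: Suc_le_eq zero_less_binomial)
next
  case (Suc m)
  let ?w = "\<lambda>i. 1 / real ((card (A i) + card (B i)) choose card (A i))"
  let ?w' = "\<lambda>x i. 1 / real ((card (A i) + card (B i - {x})) choose card (A i))"
  show ?case
  proof (cases "\<exists>i\<in>I. B i = {}")
    case True
    then obtain i where i: "i \<in> I" "B i = {}" by blast
    \<comment> \<open>No \<open>A j\<close> can meet the empty \<open>B i\<close>, so there is no
      second index; the remaining weight is 1.\<close>
    then have "I = {i}" using Suc.prems(5) by fastforce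
    then show ?thesis using i by simp
  next
    case False
    have restricted: "(\<Sum>i\<in>{i\<in>I. x \<notin> A i}. ?w' x i) \<le> 1" if x: "x \<in> X" for x
    proof (rule Suc.hyps(1)[of "X - {x}"])
      show "m = card (X - {x})" using Suc x by simp
      show "A i \<inter> (B j - {x}) \<noteq> {}" if "i \<in> {i\<in>I. x \<notin> A i}" "j \<in> {i\<in>I. x \<notin> A i}" "i \<noteq> j" for i j
        using Suc.prems(5)[of i j] that by auto
      show "A i \<inter> (B i - {x}) = {}" if "i \<in> {i\<in>I. x \<notin> A i}" for i
        using Suc.prems(4)[of i] that by auto
    qed (use Suc.prems in auto)
    have inner: "(\<Sum>x\<in>X - A i. ?w' x i) = real (card X) * ?w i" if i: "i \<in> I" for i
    proof -
      have AX: "A i \<subseteq> X" and BX: "B i \<subseteq> X" and disj: "A i \<inter> B i = {}"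
        using Suc.prems i by auto
      have fin: "finite (A i)" "finite (B i)"
        using AX BX Suc.prems(1) finite_subset by auto
      define s t where "s = card (A i)" and "t = card (B i) - 1"
      have t: "card (B i) = Suc t"
        using False i fin by (simp add: t_def card_gt_0_iff)
      \<comment> \<open>Deleting a point of \<open>B i\<close> lowers its size by one, deleting a
        point outside both sets changes nothing; by absorption the two parts add up to
        \<open>card X\<close> times the weight.\<close>
      have "(\<Sum>x\<in>X - A i. ?w' x i) = (\<Sum>x\<in>B i. ?w' x i) + (\<Sum>x\<in>X - A i - B i. ?w' x i)"
        using Suc.prems(1) BX disj by (subst sum.subset_diff[of "B i"]) auto
      also have "(\<Sum>x\<in>B i. ?w' x i) = (\<Sum>x\<in>B i. 1 / real ((s + t) choose s))"
        using t fin by (intro sum.cong) (auto simp: s_def)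
      also have "\<dots> = real (Suc t) / real ((s + t) choose s)"
        using t by simp
      also have "(\<Sum>x\<in>X - A i - B i. ?w' x i) = (\<Sum>x\<in>X - A i - B i. ?w i)"
        by (intro sum.cong) auto
      also have "\<dots> = real (card (X - A i - B i)) * ?w i" by simp
      also have "card (X - A i - B i) = card X - (s + Suc t)"
      proof -
        have "X - A i - B i = X - (A i \<union> B i)" by auto
        then show ?thesis
          using AX BX fin disj t by (simp add: card_Diff_subset card_Un_disjoint s_def)
      qed
      also have "real (card X - (s + Suc t)) = real (card X) - real (s + Suc t)"
      proof -
        have "card (A i \<union> B i) \<le> card X"
          using AX BX Suc.prems(1) by (intro card_mono) auto
        then show ?thesis using fin disj t by (simp add: card_Un_disjoint s_def)
      qed
      also have "real (Suc t) / real ((s + t) choose s) = real (s + Suc t) * ?w i"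
      proof -
        have "(s + Suc t - s) * ((s + Suc t) choose s) = (s + Suc t) * ((s + Suc t - 1) choose s)"
          by (rule binomial_absorb_comp)
        then have "Suc t * ((s + Suc t) choose s) = (s + Suc t) * ((s + t) choose s)"
          by simp
        then have "real (Suc t) * real ((s + Suc t) choose s) = real (s + Suc t) * real ((s + t) choose s)"
          by (metis of_nat_mult)
        moreover have "(s + Suc t) choose s > 0" "(s + t) choose s > 0"
          by (simp_all add: zero_less_binomial)
        ultimately show ?thesis
          unfolding t s_def[symmetric] by (simp add: field_simps)
      qed
      finally show ?thesis by (simp only: ring_distribs)
    qed
    have "real (card X) * (\<Sum>i\<in>I. ?w i) = (\<Sum>i\<in>I. \<Sum>x\<in>X - A i. ?w' x i)"
      using inner by (simp add: sum_distrib_left)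
    also have "\<dots> = (\<Sum>i\<in>I. \<Sum>x\<in>{x\<in>X. x \<notin> A i}. ?w' x i)"
      by (intro sum.cong) auto
    also have "\<dots> = (\<Sum>x\<in>X. \<Sum>i\<in>{i\<in>I. x \<notin> A i}. ?w' x i)"
      by (rule sum.swap_restrict) (use Suc.prems in auto)
    also have "\<dots> \<le> (\<Sum>x\<in>X. 1)" by (intro sum_mono restricted)
    finally have "real (card X) * (\<Sum>i\<in>I. ?w i) \<le> real (card X)" by simp
    then show ?thesis using Suc.hyps(2) by (simp add: mult_le_cancel_left1 del: of_nat_Suc)
  qed
qed

section \<open>Estimates for binomial coefficients\<close>

lemma binomial_le_central:
  assumes "m \<le> N"
  shows "m choose j \<le> N choose (N div 2)"
proof -
  have "m choose j \<le> N choose j" using assms by (rule binomial_right_mono)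
  also have "\<dots> \<le> N choose (N div 2)" by (rule binomial_maximum)
  finally show ?thesis .
qed

text \<open>Up to the common factor \<open>Suc q\<close>, the step from \<open>q\<close> to
  \<open>Suc q\<close> multiplies the sides by \<open>(N - q) * n\<close> and
  \<open>(n - q) * N\<close>, and \<open>N \<le> n\<close> orders these factors.\<close>

lemma binomial_times_power_le:
  fixes N n :: nat
  assumes "N \<le> n"
  shows "(N choose q) * n ^ q \<le> (n choose q) * N ^ q"
proof (induction q)
  case (Suc q)
  have absorb: "Suc q * (M choose Suc q) = (M - q) * (M choose q)" for M
    by (metis binomial_absorb_comp binomial_absorption)
  have "(N - q) * n \<le> (n - q) * N"
    using assms by (simp only: diff_mult_distrib mult.commute[of n N]) (simp add: diff_le_mono2)
  then have "((N - q) * n) * ((N choose q) * n ^ q) \<le> ((n - q) * N) * ((n choose q) * N ^ q)"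
    using Suc.IH by (rule mult_le_mono)
  then have "((N - q) * (N choose q)) * (n * n ^ q) \<le> ((n - q) * (n choose q)) * (N * N ^ q)"
    by (simp add: mult_ac)
  then have "Suc q * ((N choose Suc q) * n ^ Suc q) \<le> Suc q * ((n choose Suc q) * N ^ Suc q)"
    unfolding absorb[symmetric] by (simp only: power_Suc mult_ac)
  then show ?case using Suc_mult_le_cancel1 by blast
qed simp

section \<open>Upper bound by a central binomial coefficient\<close>

lemma two_small_classes:
  fixes f :: "nat \<Rightarrow> nat"
  assumes a: "a \<ge> 2"
  shows "\<exists>x<a. \<exists>y<a. x \<noteq> y \<and> a * (f x + f y) \<le> 2 * (\<Sum>z<a. f z)"
proof (rule ccontr)
  assume no: "\<not> ?thesis"
  \<comment> \<open>averaging over the cyclically consecutive pairs\<close>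
  define g where "g z = (z + 1) mod a" for z
  have less: "2 * (\<Sum>z<a. f z) < a * (f z + f (g z))" if "z < a" for z
  proof -
    have "g z < a" "z \<noteq> g z" using a that by (auto simp: g_def mod_Suc)
    then show ?thesis using no that by (metis not_le)
  qed
  have inj: "inj_on g {..<a}"
    by (auto simp: inj_on_def g_def mod_Suc split: if_splits)
  have "g ` {..<a} = {..<a}"
    using a inj by (intro endo_inj_surj) (auto simp: g_def)
  \<comment> \<open>Since \<open>g\<close> permutes the symbols, the cyclic pairs count every class
    exactly twice.\<close>
  then have shift: "(\<Sum>z<a. f (g z)) = (\<Sum>z<a. f z)"
    using sum.reindex[OF inj, of f] by simp
  have "(\<Sum>z<a. 2 * (\<Sum>z<a. f z)) < (\<Sum>z<a. a * (f z + f (g z)))"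
    using a less by (intro sum_strict_mono) (auto simp: lessThan_empty_iff)
  also have "\<dots> = a * (2 * (\<Sum>z<a. f z))"
    by (simp add: sum_distrib_left[symmetric] sum.distrib shift mult_2)
  finally show False by simp
qed

text \<open>Each vector gives two set pairs, its two small classes in either order; this is the
  factor 2. Every weight in the set-pair inequality is at least the reciprocal of the central
  coefficient.\<close>

lemma two_wise_perfect_card_le_central:
  assumes a: "a \<ge> 2" and V: "two_wise_perfect a n V"
  shows "2 * card V \<le> (2 * n div a) choose (2 * n div a div 2)"
proof -
  define S where "S v x = {r. r < n \<and> v ! r = x}" for v :: "nat list" and x :: nat
  define M where "M = (2 * n div a) choose (2 * n div a div 2)"
  have VW: "V \<subseteq> words a n" using V by (simp add: two_wise_perfect_def)
  have finV: "finite V" using VW finite_words finite_subset by blast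
  have finS: "finite (S v x)" for v x by (simp add: S_def)
  have meet: "S u x \<inter> S v y \<noteq> {}" if "u \<in> V" "v \<in> V" "u \<noteq> v" "x < a" "y < a" for u v x y
  proof -
    have "[x, y] \<in> words a 2" using that by (simp add: words_def)
    moreover have "\<forall>\<alpha>\<in>words a 2. \<exists>r<n. [u ! r, v ! r] = \<alpha>"
      using V that by (simp add: two_wise_perfect_def)
    ultimately obtain r where "r < n" "[u ! r, v ! r] = [x, y]" by metis
    then show ?thesis by (auto simp: S_def)
  qed
  have total: "(\<Sum>x<a. card (S v x)) = n" if "v \<in> V" for v
  proof -
    have "v ! r < a" if "r < n" for r
      using VW \<open>v \<in> V\<close> that nth_mem[of r v] by (fastforce simp: words_def)
    then have "(\<Union>x\<in>{..<a}. S v x) = {..<n}" by (auto simp: S_def)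
    moreover have "card (\<Union>x\<in>{..<a}. S v x) = (\<Sum>x<a. card (S v x))"
      using finS by (intro card_UN_disjoint) (auto simp: S_def)
    ultimately show ?thesis by simp
  qed
  have "\<exists>x y. x < a \<and> y < a \<and> x \<noteq> y \<and> a * (card (S v x) + card (S v y)) \<le> 2 * n"
    if "v \<in> V" for v
    using two_small_classes[OF a, of "\<lambda>x. card (S v x)"] total[OF that] by auto
  then obtain x y where xy: "x v < a" "y v < a" "x v \<noteq> y v"
      "a * (card (S v (x v)) + card (S v (y v))) \<le> 2 * n" if "v \<in> V" for v
    by metis
  \<comment> \<open>The Boolean in the index selects the order of the two classes.\<close>
  define A where "A = (\<lambda>(v, c). S v (if c then x v else y v))"
  define B where "B = (\<lambda>(v, c). S v (if c then y v else x v))"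
  have sizes: "card (A i) + card (B i) \<le> 2 * n div a" if "i \<in> V \<times> (UNIV :: bool set)" for i
    using that xy(4) a by (auto simp: A_def B_def less_eq_div_iff_mult_less_eq add.commute mult.commute)
  have sp: "(\<Sum>i\<in>V \<times> (UNIV :: bool set). 1 / real ((card (A i) + card (B i)) choose card (A i))) \<le> 1"
  proof (rule set_pair_inequality[of "{..<n}"])
    show "A i \<inter> B i = {}" if "i \<in> V \<times> UNIV" for i
      using that xy(3)[of "fst i"] by (cases i) (auto simp: A_def B_def S_def split: if_splits)
    show "A i \<inter> B j \<noteq> {}" if ij: "i \<in> V \<times> UNIV" "j \<in> V \<times> UNIV" "i \<noteq> j" for i j
    proof (cases "fst i = fst j")
      \<comment> \<open>One vector in its two orders: both sets are the same class, which is
        nonempty because it meets a class of some other vector; the symbol \<open>0\<close> chosen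
        there is arbitrary.\<close>
      case True
      then have AB: "A i = B j" using ij by (auto simp: A_def B_def split: prod.splits)
      obtain u where u: "u \<in> V" "u \<noteq> fst j"
      proof -
        have "\<not> V \<subseteq> {fst j}"
        proof
          assume "V \<subseteq> {fst j}"
          then have "card V \<le> card {fst j}" by (intro card_mono) auto
          then show False using V by (simp add: two_wise_perfect_def)
        qed
        then show ?thesis using that by blast
      qed
      have "B j \<noteq> {}"
        using meet[of "fst j" u "if snd j then y (fst j) else x (fst j)" 0] u ij xy(1,2) a
        by (auto simp: B_def split: if_splits)
      then show ?thesis using AB by simp
    next
      case False
      then show ?thesis using ij xy(1,2) meet by (auto simp: A_def B_def)
    qed
  qed (use finV in \<open>auto simp: A_def B_def S_def\<close>)
  have "(\<Sum>i\<in>V \<times> (UNIV :: bool set). 1 / real M)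
      \<le> (\<Sum>i\<in>V \<times> (UNIV :: bool set). 1 / real ((card (A i) + card (B i)) choose card (A i)))"
  proof (intro sum_mono divide_left_mono)
    fix i assume "i \<in> V \<times> (UNIV :: bool set)"
    then show "real ((card (A i) + card (B i)) choose card (A i)) \<le> real M"
      unfolding M_def of_nat_le_iff by (intro binomial_le_central sizes)
  qed (auto simp: M_def zero_less_binomial)
  also note sp
  finally have "real (2 * card V) / real M \<le> 1"
    by (simp add: card_cartesian_product mult.commute)
  moreover have "M > 0" by (simp add: M_def zero_less_binomial)
  ultimately have "real (2 * card V) \<le> real M" by (simp add: divide_le_eq)
  then show ?thesis unfolding M_def of_nat_le_iff .
qed

section \<open>From the central coefficient to the stated upper bound\<close>

text \<open>For \<open>a = 2\<close> both sides are 1. For \<open>a \<ge> 3\<close> the exponent 3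
  already suffices, and \<open>q \<ge> a\<close> allows raising it.\<close>

lemma choose_two_le_half_power:
  assumes a: "a \<ge> 2" and q: "a \<le> q"
  shows "real (a choose 2) \<le> (real a / 2) ^ q"
proof (cases "a = 2")
  case False
  have "real (a choose 2) = real a * (real a - 1) / 2"
    using a by (simp add: choose_two real_of_nat_div)
  also have "\<dots> \<le> (real a / 2) ^ 3"
  proof -
    \<comment> \<open>This is 8 times the difference of the two sides.\<close>
    have "0 \<le> real a * (real a - 2)\<^sup>2" by simp
    then show ?thesis by (simp add: power2_eq_square power3_eq_cube field_simps)
  qed
  also have "\<dots> \<le> (real a / 2) ^ q"
    using a q False by (intro power_increasing) auto
  finally show ?thesis .
qed (simp add: numeral_2_eq_2)

lemma choose_two_central_le:
  assumes a: "a \<ge> 2" and n: "n \<ge> a\<^sup>2"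
  shows "(a choose 2) * ((2 * n div a) choose (2 * n div a div 2)) \<le> n choose (n div a)"
proof -
  define N q where "N = 2 * n div a" and "q = n div a"
  \<comment> \<open>Here \<open>n \<ge> a\<^sup>2\<close> makes the exponent large enough for
    \<open>choose_two_le_half_power\<close>.\<close>
  have q: "a \<le> q"
    using a n by (simp add: q_def less_eq_div_iff_mult_less_eq power2_eq_square)
  \<comment> \<open>Nested floors agree, so the central index of \<open>N\<close> is also the lower
    index on the right.\<close>
  have Nq: "N div 2 = q"
    by (simp add: N_def q_def div_mult2_eq[symmetric] mult.commute[of a 2])
  have N0: "N > 0" using Nq q a by (cases N) auto
  have Na: "N * a \<le> 2 * n" by (simp add: N_def)
  have Nn: "N \<le> n"
  proof -
    have "N * 2 \<le> N * a" using a by simp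
    then show ?thesis using Na by linarith
  qed
  have "real (a choose 2) * real (N choose q) \<le> (real a / 2) ^ q * real (N choose q)"
    using choose_two_le_half_power[OF a q] by (intro mult_right_mono) auto
  also have "\<dots> \<le> (real n / real N) ^ q * real (N choose q)"
  proof (intro mult_right_mono power_mono)
    have "real N * real a \<le> 2 * real n" using Na by (metis of_nat_le_iff of_nat_mult of_nat_numeral)
    then show "real a / 2 \<le> real n / real N" using N0 by (simp add: field_simps)
  qed auto
  also have "\<dots> \<le> real (n choose q)"
  proof -
    have "real (N choose q) * real n ^ q \<le> real (n choose q) * real N ^ q"
      using binomial_times_power_le[OF Nn, of q] by (metis of_nat_le_iff of_nat_mult of_nat_power)
    then show ?thesis using N0 by (simp add: field_simps)
  qed
  finally have "real ((a choose 2) * (N choose q)) \<le> real (n choose q)" by simp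
  then show ?thesis unfolding of_nat_le_iff using Nq by (simp add: N_def q_def)
qed

text \<open>If floor and ceiling of \<open>n / a\<close> differ, the floor lies below
  \<open>n / 2\<close>, where the next binomial coefficient is not smaller.\<close>

lemma two_wise_perfect_card_le:
  assumes a: "a \<ge> 2" and n: "n \<ge> a\<^sup>2" and V: "two_wise_perfect a n V"
  shows "2 * (a choose 2) * card V \<le> n choose nat \<lceil>real n / real a\<rceil>"
proof -
  define q m where "q = n div a" and "m = nat \<lceil>real n / real a\<rceil>"
  have "2 * (a choose 2) * card V \<le> (a choose 2) * ((2 * n div a) choose (2 * n div a div 2))"
    using two_wise_perfect_card_le_central[OF a V] by simp
  also have "\<dots> \<le> n choose q" unfolding q_def by (rule choose_two_central_le[OF a n])
  also have "\<dots> \<le> n choose m"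
  proof -
    have fl: "\<lfloor>real n / real a\<rfloor> = int q" by (simp add: q_def floor_divide_of_nat_eq)
    have "m = q \<or> m = Suc q"
    proof -
      have "\<lceil>real n / real a\<rceil> = int q \<or> \<lceil>real n / real a\<rceil> = int q + 1"
        using fl by linarith
      then show ?thesis by (auto simp: m_def nat_add_distrib)
    qed
    moreover have "n choose q \<le> n choose Suc q" if "m = Suc q"
    proof (cases "2 * q < n")
      case True
      have "Suc q * (n choose q) \<le> (n - q) * (n choose q)"
        using True by (intro mult_right_mono) auto
      also have "\<dots> = Suc q * (n choose Suc q)"
        by (metis binomial_absorb_comp binomial_absorption)
      finally show ?thesis using Suc_mult_le_cancel1 by blast
    next
      case False
      \<comment> \<open>Together with \<open>n \<le> 2 * q\<close> this forces exact division, so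
        the ceiling equals \<open>q\<close>, against \<open>m = Suc q\<close>.\<close>
      have "a * q \<le> n" by (simp add: q_def)
      moreover have "2 * q \<le> a * q" using a by simp
      ultimately have "n = a * q" using False by linarith
      then have "m = q" using a by (simp add: m_def)
      then show ?thesis using that by simp
    qed
    ultimately show ?thesis by auto
  qed
  finally show ?thesis by (simp add: m_def)
qed

section \<open>The maximum size as an attained bound\<close>

lemma two_wise_perfect_le_max:
  assumes "two_wise_perfect a n V"
  shows "card V \<le> max_two_wise_perfect a n"
  unfolding max_two_wise_perfect_def
  using assms finite_two_wise_perfect by (intro Max_ge) auto

lemma max_two_wise_perfect_attained:
  assumes "a \<ge> 2" and "n \<ge> a\<^sup>2"
  obtains V where "two_wise_perfect a n V" "card V = max_two_wise_perfect a n"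
proof -
  have "max_two_wise_perfect a n \<in> card ` {V. two_wise_perfect a n V}"
    unfolding max_two_wise_perfect_def
    using two_wise_perfect_exists[OF assms] finite_two_wise_perfect by (intro Max_in) auto
  then show ?thesis using that by auto
qed

section \<open>Lower bound from subsets of half size\<close>

text \<open>Removing \<open>0\<close> leaves the \<open>(k - 1)\<close>-subsets of
  \<open>2 * k - 1\<close> points; by absorption they number half of the central
  coefficient.\<close>

lemma card_halves_containing:
  assumes k: "k \<ge> 1"
  shows "2 * card {S. S \<subseteq> {..<2 * k} \<and> card S = k \<and> 0 \<in> S} = (2 * k) choose k"
proof -
  let ?H = "{S. S \<subseteq> {..<2 * k} \<and> card S = k \<and> 0 \<in> S}"
  let ?T = "{T. T \<subseteq> {1..<2 * k} \<and> card T = k - 1}"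
  have "bij_betw (insert 0) ?T ?H"
  proof (rule bij_betw_byWitness[where f' = "\<lambda>S. S - {0}"])
    show "insert 0 ` ?T \<subseteq> ?H"
    proof (rule image_subsetI)
      fix T assume T: "T \<in> ?T"
      then have "finite T" "0 \<notin> T" using finite_subset by auto
      then show "insert 0 T \<in> ?H" using T k by auto
    qed
    show "(\<lambda>S. S - {0}) ` ?H \<subseteq> ?T"
    proof (rule image_subsetI)
      fix S assume S: "S \<in> ?H"
      have "x \<in> {1..<2 * k}" if "x \<in> S - {0}" for x
        using S that by (cases x) auto
      then show "S - {0} \<in> ?T" using S by (simp add: subset_iff)
    qed
    show "\<forall>T\<in>?T. insert 0 T - {0} = T"
      by (metis (no_types, lifting) Diff_insert_absorb atLeastLessThan_iff
          mem_Collect_eq not_one_le_zero subsetD)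
    show "\<forall>S\<in>?H. insert 0 (S - {0}) = S"
      by (simp add: insert_absorb)
  qed
  then have "card ?H = card ?T" by (rule bij_betw_same_card[symmetric])
  also have "\<dots> = (2 * k - 1) choose (k - 1)"
    using n_subsets[of "{1..<2 * k}" "k - 1"] by simp
  finally have H: "card ?H = (2 * k - 1) choose (k - 1)" .
  obtain l where l: "k = Suc l" using k by (cases k) auto
  have "Suc l * ((2 * k) choose k) = Suc l * (2 * ((2 * k - 1) choose (k - 1)))"
    using binomial_absorption[of l "2 * k"] by (simp add: l)
  then show ?thesis using H by (metis Suc_mult_cancel1)
qed

text \<open>The bound \<open>k \<ge> 2\<close> ensures at least two vectors: for
  \<open>k = 1\<close> the family consists of \<open>{0}\<close> alone.\<close>

lemma two_wise_perfect_halves: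
  assumes a: "a \<ge> 2" and k: "k \<ge> 2" and len: "2 * k * (a choose 2) \<le> n"
  shows "\<exists>V. two_wise_perfect a n V \<and> 2 * card V = (2 * k) choose k"
proof -
  define b where "b = a choose 2"
  define H where "H = {S. S \<subseteq> {..<2 * k} \<and> card S = k \<and> 0 \<in> S}"
  \<comment> \<open>Each unordered pair of distinct symbols occurs once, larger symbol first, and
    will own one block of coordinates.\<close>
  define P where "P = (SIGMA y:{..<a}. {..<y})"
  have cardP: "card P = b"
    by (simp add: P_def b_def choose_two gauss_sum_nat lessThan_atLeast0 Sum_Ico_nat)
  have finP: "finite P" by (simp add: P_def)
  obtain e where e: "bij_betw e {0..<b} P"
    using ex_bij_betw_nat_finite[OF finP] cardP by metis
  \<comment> \<open>The quotient of \<open>r\<close> by \<open>2 * k\<close> names the block, the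
    remainder the point tested against \<open>S\<close>; members receive the larger symbol.
    Coordinates past the \<open>b\<close> blocks are padded with \<open>0\<close>.\<close>
  define symb where "symb S r =
      (if r div (2 * k) < b
       then if r mod (2 * k) \<in> S then fst (e (r div (2 * k))) else snd (e (r div (2 * k)))
       else 0)" for S r
  define w where "w S = map (symb S) [0..<n]" for S
  have "symb S r < a" for S r
  proof (cases "r div (2 * k) < b")
    case True
    then have "e (r div (2 * k)) \<in> P" using e by (auto simp: bij_betw_def)
    then show ?thesis by (auto simp: symb_def P_def)
  qed (use a in \<open>auto simp: symb_def\<close>)
  then have w_words: "w S \<in> words a n" for S
    by (auto simp: w_def words_def)
  have pattern: "\<exists>i<2 * k. (i \<in> S \<longleftrightarrow> c) \<and> (i \<in> T \<longleftrightarrow> d)"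
    if S: "S \<in> H" and T: "T \<in> H" and ne: "S \<noteq> T" for S T and c d
  proof -
    have fin: "finite S" "finite T" using S T finite_subset by (auto simp: H_def)
    \<comment> \<open>Distinct sets of equal size are incomparable, and sharing \<open>0\<close>
      they cannot cover all \<open>2 * k\<close> points, so all four membership patterns
      occur.\<close>
    have 1: "\<not> S \<subseteq> T" "\<not> T \<subseteq> S"
      using S T ne fin by (auto simp: H_def dest: card_subset_eq)
    have "card (S \<inter> T) \<ge> 1"
      using S T fin by (auto simp: H_def Suc_le_eq card_gt_0_iff)
    then have "card (S \<union> T) < 2 * k"
      using card_Un_Int[OF fin] S T by (simp add: H_def)
    then have "\<not> {..<2 * k} \<subseteq> S \<union> T"
      using fin card_mono[of "S \<union> T" "{..<2 * k}"] by auto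
    then have 2: "\<exists>i<2 * k. i \<notin> S \<and> i \<notin> T" by auto
    have 3: "0 < 2 * k" "0 \<in> S" "0 \<in> T" using k S T by (auto simp: H_def)
    have 4: "S \<subseteq> {..<2 * k}" "T \<subseteq> {..<2 * k}" using S T by (auto simp: H_def)
    show ?thesis using 1 2 3 4 by (cases c; cases d) blast+
  qed
  have block: "\<exists>r<n. symb S r = (if c then y else x) \<and> symb T r = (if d then y else x)"
    if ST: "S \<in> H" "T \<in> H" "S \<noteq> T" and xy: "x < y" "y < a" for S T c d x y
  proof -
    have "(y, x) \<in> P" using xy by (simp add: P_def)
    then obtain j where j: "j < b" "e j = (y, x)" using e by (auto simp: bij_betw_def)
    obtain i where i: "i < 2 * k" "i \<in> S \<longleftrightarrow> c" "i \<in> T \<longleftrightarrow> d"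
      using pattern[OF ST] by blast
    have "j * (2 * k) + i < Suc j * (2 * k)" using i by simp
    also have "\<dots> \<le> b * (2 * k)" using j by (intro mult_right_mono) auto
    also have "\<dots> \<le> n" using len by (simp add: b_def mult.commute)
    finally have "j * (2 * k) + i < n" .
    moreover have "(j * (2 * k) + i) div (2 * k) = j" "(j * (2 * k) + i) mod (2 * k) = i"
      using i by (simp_all only: div_mult_self3 mod_mult_self3 div_less mod_less)
    ultimately show ?thesis
      using i j by (intro exI[of _ "j * (2 * k) + i"]) (simp add: symb_def)
  qed
  have cover: "\<exists>r<n. symb S r = x \<and> symb T r = y"
    if ST: "S \<in> H" "T \<in> H" "S \<noteq> T" and xy: "x < a" "y < a" for S T x y
  proof (cases x y rule: linorder_cases)
    case less
    then show ?thesis using block[OF ST less xy(2), of False True] by simp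
  next
    case greater
    then show ?thesis using block[OF ST greater xy(1), of True False] by simp
  next
    case equal
    show ?thesis
    \<comment> \<open>A repeated \<open>0\<close> is found outside both sets in the block of
      \<open>0\<close> and \<open>1\<close>, a repeated nonzero \<open>x\<close> inside both sets in
      the block of \<open>0\<close> and \<open>x\<close>.\<close>
    proof (cases "x = 0")
      case True
      then show ?thesis using block[OF ST, of 0 1 False False] a equal by simp
    next
      case False
      then show ?thesis using block[OF ST, of 0 x True True] xy equal by simp
    qed
  qed
  have inj: "inj_on w H"
  proof (rule inj_onI, rule ccontr)
    fix S T assume "S \<in> H" "T \<in> H" "w S = w T" "S \<noteq> T"
    then obtain r where "r < n" "symb S r = 0" "symb T r = 1"
      using cover[of S T 0 1] a by auto
    moreover have "w S ! r = symb S r" "w T ! r = symb T r"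
      using \<open>r < n\<close> by (simp_all add: w_def)
    ultimately show False using \<open>w S = w T\<close> by simp
  qed
  have cardV: "2 * card (w ` H) = (2 * k) choose k"
    using card_halves_containing[of k] k card_image[OF inj] by (simp add: H_def)
  have "4 choose 2 \<le> (2 * k) choose (2 * k div 2)"
    using k by (intro binomial_le_central) simp
  then have "2 \<le> card (w ` H)" using cardV by (simp add: choose_two)
  moreover have "\<exists>r<n. [w S ! r, w T ! r] = \<alpha>"
    if ST: "S \<in> H" "T \<in> H" "w S \<noteq> w T" and "\<alpha> \<in> words a 2" for S T and \<alpha> :: "nat list"
  proof -
    obtain x y where "\<alpha> = [x, y]" "x < a" "y < a"
      using \<open>\<alpha> \<in> words a 2\<close> by (auto simp: words_def length_Suc_conv numeral_2_eq_2)
    moreover have "S \<noteq> T" using ST by auto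
    ultimately obtain r where "r < n" "symb S r = x" "symb T r = y"
      using cover[of S T x y] ST by blast
    then show ?thesis using \<open>\<alpha> = [x, y]\<close> by (intro exI[of _ r]) (simp add: w_def)
  qed
  ultimately have "two_wise_perfect a n (w ` H)"
    using w_words by (auto simp: two_wise_perfect_def)
  then show ?thesis using cardV by blast
qed

theorem theorem4:
  fixes a n b k :: nat
  assumes "a \<ge> 2" and "n \<ge> a\<^sup>2"
    and "b = a choose 2"
    and "k = nat \<lfloor>real n / (2 * real b)\<rfloor>"
  shows "1 / 2 * real ((2 * k) choose k) \<le> real (max_two_wise_perfect a n) \<and>
         real (max_two_wise_perfect a n)
           \<le> 1 / (2 * real b) * real (n choose nat \<lceil>real n / real a\<rceil>)"
proof
  obtain V where V: "two_wise_perfect a n V" "card V = max_two_wise_perfect a n"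
    using max_two_wise_perfect_attained[OF assms(1,2)] .
  have b: "b > 0" using assms by (simp add: zero_less_binomial)
  have k: "k = n div (2 * b)"
    using floor_divide_of_nat_eq[of n "2 * b", where ?'a = real] assms(4) by simp
  have "(2 * k) choose k \<le> 2 * max_two_wise_perfect a n"
  proof (cases "k \<ge> 2")
    case True
    have "2 * k * (a choose 2) \<le> n"
      using times_div_less_eq_dividend[of "2 * b" n] k assms(3) by (simp add: mult_ac)
    then show ?thesis
      using two_wise_perfect_halves[OF assms(1) True] two_wise_perfect_le_max by fastforce
  next
    \<comment> \<open>For \<open>k \<le> 1\<close> the construction is replaced by the fact that
      every perfect set has at least two members.\<close>
    case False
    then have "k = 0 \<or> k = 1" by auto
    then have "(2 * k) choose k \<le> 2" by auto
    moreover have "max_two_wise_perfect a n \<ge> 2"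
      using V by (simp add: two_wise_perfect_def)
    ultimately show ?thesis by linarith
  qed
  then show "1 / 2 * real ((2 * k) choose k) \<le> real (max_two_wise_perfect a n)" by linarith
  have "2 * b * max_two_wise_perfect a n \<le> n choose nat \<lceil>real n / real a\<rceil>"
    using two_wise_perfect_card_le[OF assms(1,2) V(1)] V(2) assms(3) by simp
  then have "2 * real b * real (max_two_wise_perfect a n) \<le> real (n choose nat \<lceil>real n / real a\<rceil>)"
    by (metis of_nat_le_iff of_nat_mult of_nat_numeral)
  then show "real (max_two_wise_perfect a n)
      \<le> 1 / (2 * real b) * real (n choose nat \<lceil>real n / real a\<rceil>)"
    using b by (simp add: field_simps)
qed

end
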